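(* Let $n$ be a positive integer, let $G_n$ be the state graph of the $n$-disk Tower of Hanoi, and regard $G_n$ as an electrical network with a resistor of $1$ ohm on every edge. Then, for the purpose of computing effective resistances between any two of the three corner nodes $A(n), B(n), C(n)$, this network is equivalent to a wye: a network consisting of a single center node joined to each of $A(n)$, $B(n)$, $C(n)$ by a link of one and the same resistance $R(n)$. In other words, there is $R(n)>0$ such that the effective resistance of $G_n$ between any two distinct corner nodes equals $2R(n)$.
   Context: The $n$-disk Tower of Hanoi has $3$ pegs and disks of sizes $1,\dots,n$; a state is an assignment of each disk to a peg (disks on each peg stacked with sizes decreasing from bottom to top), giving $3^n$ states. A legal move takes the top disk of one peg and places it on top of another peg, provided that peg is empty or its top disk is larger. The state graph $G_n$ has the $3^n$ states as vertices, with an edge between two states whenever one is obtained from the other by a single legal move. The corner nodes are $A(n)$, $B(n)$, $C(n)$: the states with all disks on peg $1$, on peg $2$, and on peg $3$, respectively. Effective resistance between two nodes is that of the resistor network in the usual (Kirchhoff) sense. *)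

theory Defs
  imports Complex_Main "HOL-Library.FuncSet" "Graph_Theory.Pair_Digraph"
begin

section \<open>Resistor networks\<close>

text \<open>
  A resistor network is a finite undirected graph \<open>G\<close>, each edge being represented by its two
  opposite arcs, together with a function \<open>r\<close> that is positive and symmetric on the arcs of \<open>G\<close>:
  \<open>r x y\<close> is the resistance of the edge between \<open>x\<close> and \<open>y\<close>.

  The following predicate says that \<open>v\<close> is the node potential when a unit current enters the
  network at \<open>a\<close> and leaves it at \<open>b\<close>.  By Ohm's law, the current along the arc \<open>(x, y)\<close> is
  \<open>(v x - v y) / r x y\<close>; Kirchhoff's current law is imposed at every node.  Kirchhoff's voltage law
  holds because the currents come from a potential.
\<close>

definition unit_current_potential ::
    "'a pair_pre_digraph \<Rightarrow> ('a \<Rightarrow> 'a \<Rightarrow> real) \<Rightarrow> 'a \<Rightarrow> 'a \<Rightarrow> ('a \<Rightarrow> real) \<Rightarrow> bool" where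
  "unit_current_potential G r a b v \<longleftrightarrow>
     (\<forall>x\<in>pverts G. (\<Sum>y | (x, y) \<in> parcs G. (v x - v y) / r x y)
        = (if x = a then 1 else 0) - (if x = b then 1 else 0))"

definition effective_resistance ::
    "'a pair_pre_digraph \<Rightarrow> ('a \<Rightarrow> 'a \<Rightarrow> real) \<Rightarrow> 'a \<Rightarrow> 'a \<Rightarrow> real" where
  "effective_resistance G r a b = (THE \<rho>. \<exists>v. unit_current_potential G r a b v \<and> \<rho> = v a - v b)"

text \<open>
  The potential difference does not depend on the choice of the potential, so the definite
  description is meaningful as soon as a potential exists.
\<close>

lemma unit_current_potential_diff_unique:
  assumes G: "pair_pseudo_graph G"
    and r_sym: "\<And>x y. (x, y) \<in> parcs G \<Longrightarrow> r x y = r y x"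
    and ab: "a \<in> pverts G" "b \<in> pverts G"
    and v: "unit_current_potential G r a b v"
    and w: "unit_current_potential G r a b w"
  shows "v a - v b = w a - w b"
proof -
  interpret pair_pseudo_graph G by (fact G)
  let ?V = "pverts G"
  define c where "c x y = (if (x, y) \<in> parcs G then 1 / r x y else 0)" for x y
  have E_sym: "(y, x) \<in> parcs G" if "(x, y) \<in> parcs G" for x y
    using that pair_sym_arcs by (auto simp: symmetric_def elim: symE)
  have c_sym: "c x y = c y x" for x y
    unfolding c_def using r_sym E_sym by auto
  have div: "(\<Sum>y | (x, y) \<in> parcs G. (f x - f y) / r x y) = (\<Sum>y\<in>?V. c x y * (f x - f y))"
    for f x
  proof -
    have "(\<Sum>y\<in>?V. c x y * (f x - f y)) = (\<Sum>y\<in>{y \<in> ?V. (x, y) \<in> parcs G}. (f x - f y) / r x y)"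
      unfolding sum.inter_filter[OF pair_finite_verts] by (intro sum.cong) (auto simp: c_def)
    also have "{y \<in> ?V. (x, y) \<in> parcs G} = {y. (x, y) \<in> parcs G}"
      by (auto dest: in_arcsD2)
    finally show ?thesis by simp
  qed
  have pair: "(\<Sum>x\<in>?V. f x * (\<Sum>y\<in>?V. c x y * (g x - g y))) = f a - f b"
    if g: "unit_current_potential G r a b g" for f g
  proof -
    have "(\<Sum>x\<in>?V. f x * (\<Sum>y\<in>?V. c x y * (g x - g y)))
        = (\<Sum>x\<in>?V. f x * ((if x = a then 1 else 0) - (if x = b then 1 else 0)))"
      using g by (intro sum.cong) (simp_all add: unit_current_potential_def div)
    also have "\<dots> = (\<Sum>x\<in>?V. (if x = a then f x else 0)) - (\<Sum>x\<in>?V. (if x = b then f x else 0))"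
      by (subst sum_subtractf[symmetric], intro sum.cong) auto
    also have "\<dots> = f a - f b"
      using ab pair_finite_verts by simp
    finally show ?thesis .
  qed
  have expand: "(\<Sum>x\<in>?V. f x * (\<Sum>y\<in>?V. c x y * (g x - g y)))
      = (\<Sum>x\<in>?V. \<Sum>y\<in>?V. c x y * f x * g x) - (\<Sum>x\<in>?V. \<Sum>y\<in>?V. c x y * f x * g y)" for f g
    by (simp add: sum_distrib_left sum_subtractf[symmetric] algebra_simps)
  have "(\<Sum>x\<in>?V. \<Sum>y\<in>?V. c x y * v x * w y) = (\<Sum>x\<in>?V. \<Sum>y\<in>?V. c x y * w x * v y)"
    by (subst sum.swap, intro sum.cong refl) (simp add: c_sym mult_ac)
  then have "(\<Sum>x\<in>?V. v x * (\<Sum>y\<in>?V. c x y * (w x - w y)))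
      = (\<Sum>x\<in>?V. w x * (\<Sum>y\<in>?V. c x y * (v x - v y)))"
    unfolding expand by (simp add: mult_ac)
  then show ?thesis
    using pair[OF w, of v] pair[OF v, of w] by simp
qed

lemma effective_resistance_eqI:
  assumes "pair_pseudo_graph G"
    and "\<And>x y. (x, y) \<in> parcs G \<Longrightarrow> r x y = r y x"
    and "a \<in> pverts G" "b \<in> pverts G"
    and "unit_current_potential G r a b v"
  shows "effective_resistance G r a b = v a - v b"
  unfolding effective_resistance_def
  using unit_current_potential_diff_unique[of G r a b, OF assms(1-4)] assms(5)
  by (intro the_equality) blast+

text \<open>
  Two networks are equivalent, as far as effective resistances between the terminals in \<open>T\<close> are
  concerned; \<open>\<phi>\<close> identifies the terminals of the first network with nodes of the second.
\<close>

definition equivalent_networks ::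
    "'a set \<Rightarrow> ('a \<Rightarrow> 'b) \<Rightarrow> 'a pair_pre_digraph \<Rightarrow> ('a \<Rightarrow> 'a \<Rightarrow> real)
      \<Rightarrow> 'b pair_pre_digraph \<Rightarrow> ('b \<Rightarrow> 'b \<Rightarrow> real) \<Rightarrow> bool" where
  "equivalent_networks T \<phi> G r H s \<longleftrightarrow>
     (\<forall>a\<in>T. \<forall>b\<in>T. effective_resistance G r a b = effective_resistance H s (\<phi> a) (\<phi> b))"

text \<open>The star on the terminals \<open>T\<close>, with \<open>None\<close> as its center; a wye when \<open>T\<close> has three elements.\<close>

definition star_graph :: "'a set \<Rightarrow> 'a option pair_pre_digraph" where
  "star_graph T = \<lparr> pverts = insert None (Some ` T),
     parcs = (\<Union>t\<in>T. {(None, Some t), (Some t, None)}) \<rparr>"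

lemma pair_graph_star_graph: "finite T \<Longrightarrow> pair_graph (star_graph T)"
  by unfold_locales (auto simp: star_graph_def symmetric_def sym_def)


section \<open>The Tower of Hanoi\<close>

text \<open>
  A state maps each disk to its peg.  The disk \<open>d\<close> has size \<open>d\<close>, so the order of the disks on a
  peg is determined by the state, and the top disk of a nonempty peg is its minimal one.
\<close>

definition hanoi_states :: "nat \<Rightarrow> (nat \<Rightarrow> nat) set" where
  "hanoi_states n = {1..n} \<rightarrow>\<^sub>E {1, 2, 3}"

definition disks_on :: "nat \<Rightarrow> (nat \<Rightarrow> nat) \<Rightarrow> nat \<Rightarrow> nat set" where
  "disks_on n s p = {d \<in> {1..n}. s d = p}"

definition legal_move :: "nat \<Rightarrow> (nat \<Rightarrow> nat) \<Rightarrow> (nat \<Rightarrow> nat) \<Rightarrow> bool" where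
  "legal_move n s t \<longleftrightarrow>
     (\<exists>p\<in>{1, 2, 3}. \<exists>q\<in>{1, 2, 3}. p \<noteq> q \<and> disks_on n s p \<noteq> {} \<and>
        (disks_on n s q = {} \<or> Min (disks_on n s p) < Min (disks_on n s q)) \<and>
        t = s(Min (disks_on n s p) := q))"

definition hanoi_graph :: "nat \<Rightarrow> (nat \<Rightarrow> nat) pair_pre_digraph" where
  "hanoi_graph n = \<lparr> pverts = hanoi_states n,
     parcs = {(s, t). s \<in> hanoi_states n \<and> t \<in> hanoi_states n \<and>
                      (legal_move n s t \<or> legal_move n t s)} \<rparr>"

definition corner :: "nat \<Rightarrow> nat \<Rightarrow> (nat \<Rightarrow> nat)" where
  "corner n p = (\<lambda>d\<in>{1..n}. p)"

definition corners :: "nat \<Rightarrow> (nat \<Rightarrow> nat) set" where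
  "corners n = {corner n 1, corner n 2, corner n 3}"

lemma card_hanoi_states: "card (hanoi_states n) = 3 ^ n"
  by (simp add: hanoi_states_def card_PiE eval_nat_numeral)

lemma corners_subset: "corners n \<subseteq> hanoi_states n"
  by (auto simp: corners_def corner_def hanoi_states_def)

lemma card_corners:
  assumes "n \<ge> 1"
  shows "card (corners n) = 3"
proof -
  have "corner n p \<noteq> corner n q" if "p \<noteq> q" for p q
    using that assms by (auto simp: corner_def fun_eq_iff restrict_def intro!: exI[of _ 1])
  then show ?thesis by (simp add: corners_def)
qed

lemma legal_move_neq: "legal_move n s t \<Longrightarrow> s \<noteq> t"
proof
  assume "legal_move n s t" and st: "s = t"
  then obtain p q where pq: "p \<noteq> q" "disks_on n s p \<noteq> {}" and t: "t = s(Min (disks_on n s p) := q)"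
    unfolding legal_move_def by blast
  have "Min (disks_on n s p) \<in> disks_on n s p"
    using pq(2) by (intro Min_in) (auto simp: disks_on_def)
  then have "s (Min (disks_on n s p)) = p"
    by (simp add: disks_on_def)
  moreover have "s (Min (disks_on n s p)) = q"
    using fun_cong[OF t, of "Min (disks_on n s p)"] st by simp
  ultimately show False
    using pq(1) by simp
qed

lemma pair_graph_hanoi_graph: "pair_graph (hanoi_graph n)"
proof -
  have fin: "finite (hanoi_states n)"
    by (simp add: hanoi_states_def finite_PiE)
  have "finite {(s, t). s \<in> hanoi_states n \<and> t \<in> hanoi_states n \<and>
                 (legal_move n s t \<or> legal_move n t s)}"
    by (rule finite_subset[of _ "hanoi_states n \<times> hanoi_states n"]) (use fin in auto)
  then show ?thesis
    using fin
    by unfold_locales (auto simp: hanoi_graph_def symmetric_def sym_def dest: legal_move_neq)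
qed

end

theory Submission
  imports Defs
begin

text \<open>
  If currents \<open>i 1\<close>, \<open>i 2\<close>, \<open>i 3\<close> of sum zero enter a wye at its terminals and its center is at
  potential zero, then the terminal \<open>p\<close> is at potential \<open>R * i p\<close>. By induction on \<open>n\<close>, \<open>G\<^sub>n\<close> has a
  potential with exactly these boundary values. \<open>G\<^bsub>n+1\<^esub>\<close> consists of three copies of \<open>G\<^sub>n\<close>, one for
  each peg of the largest disk; if \<open>{p, q, r} = {1, 2, 3}\<close>, then the corner \<open>q\<close> of the copy \<open>p\<close> is
  joined to the corner \<open>q\<close> of the copy \<open>r\<close>. Sending the current \<open>(i p - i r) / 3\<close> along this edge
  and raising the potential of the copy \<open>p\<close> by \<open>(2 R + 1) / 3 * i p\<close> satisfies all the laws, and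
  the corner \<open>p\<close> is then at potential \<open>(5 R + 1) / 3 * i p\<close>.
\<close>

section \<open>Star networks\<close>

text \<open>Ground the center. Each leaf then sits at \<open>R\<close> times the current entering
  there: \<open>R\<close> at \<open>a\<close>, \<open>- R\<close> at \<open>b\<close>,
  \<open>0\<close> elsewhere, and \<open>0\<close> throughout when \<open>a = b\<close>.\<close>

lemma effective_resistance_star_graph:
  assumes "finite T" "a \<in> T" "b \<in> T" "R > 0"
  shows "effective_resistance (star_graph T) (\<lambda>_ _. R) (Some a) (Some b)
    = (if a = b then 0 else 2 * R)"
proof -
  define v where "v = case_option 0 (\<lambda>t. R * (of_bool (t = a) - of_bool (t = b)))"
  have center: "{y. (None, y) \<in> parcs (star_graph T)} = Some ` T"
    by (auto simp: star_graph_def)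
  have leaf: "{y. (Some t, y) \<in> parcs (star_graph T)} = {None}" if "t \<in> T" for t
    using that by (auto simp: star_graph_def)
  have "(\<Sum>t\<in>T. (v None - v (Some t)) / R)
      = (\<Sum>t\<in>T. (if t = b then 1 else 0) - (if t = a then 1 else 0))"
    using assms(4) by (intro sum.cong) (auto simp: v_def)
  also have "\<dots> = 0"
    using assms(1-3) by (simp add: sum_subtractf)
  finally have zero: "(\<Sum>t\<in>T. (v None - v (Some t)) / R) = 0" .
  have "unit_current_potential (star_graph T) (\<lambda>_ _. R) (Some a) (Some b) v"
    unfolding unit_current_potential_def
  proof
    fix x assume "x \<in> pverts (star_graph T)"
    then consider "x = None" | t where "x = Some t" "t \<in> T"
      by (auto simp: star_graph_def)
    then show "(\<Sum>y | (x, y) \<in> parcs (star_graph T). (v x - v y) / R)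
        = (if x = Some a then 1 else 0) - (if x = Some b then 1 else 0)"
    proof cases
      case 1
      then show ?thesis using zero by (simp add: center sum.reindex)
    next
      case 2
      then show ?thesis using assms(4) by (simp add: leaf v_def)
    qed
  qed
  moreover have "pair_pseudo_graph (star_graph T)"
    using pair_graph_star_graph[OF assms(1)] by (simp add: pair_graph_def)
  ultimately have "effective_resistance (star_graph T) (\<lambda>_ _. R) (Some a) (Some b)
      = v (Some a) - v (Some b)"
    using assms(2,3) by (intro effective_resistance_eqI) (auto simp: star_graph_def)
  then show ?thesis by (simp add: v_def)
qed

section \<open>Neighbours in the Hanoi graph\<close>

text \<open>A condition on the smaller disks replaces the minima of \<open>legal_move\<close>, so
  that neighbours can be sorted by the disk that moves.\<close>

definition move_disk :: "(nat \<Rightarrow> nat) \<Rightarrow> nat \<Rightarrow> (nat \<Rightarrow> nat) set" where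
  "move_disk s d = {s(d := q) | q. q \<in> {1, 2, 3} \<and> q \<noteq> s d \<and> (\<forall>e\<in>{1..<d}. s e \<noteq> s d \<and> s e \<noteq> q)}"

text \<open>
  The state \<open>s\<close> need not be extensional here: this lets a state of \<open>n + 1\<close> disks serve as a state
  of its \<open>n\<close> smallest disks.
\<close>

definition hanoi_nbrs :: "nat \<Rightarrow> (nat \<Rightarrow> nat) \<Rightarrow> (nat \<Rightarrow> nat) set" where
  "hanoi_nbrs n s = (\<Union>d\<in>{1..n}. move_disk s d)"

lemma finite_move_disk: "finite (move_disk s d)"
  unfolding move_disk_def by (rule finite_subset[of _ "(\<lambda>q. s(d := q)) ` {1, 2, 3}"]) auto

lemma hanoi_nbrs_iff:
  "t \<in> hanoi_nbrs n s \<longleftrightarrow> (\<exists>d q. d \<in> {1..n} \<and> q \<in> {1, 2, 3} \<and> q \<noteq> s d \<and>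
    (\<forall>e\<in>{1..<d}. s e \<noteq> s d \<and> s e \<noteq> q) \<and> t = s(d := q))"
  unfolding hanoi_nbrs_def move_disk_def by blast

lemma hanoi_nbrs_0 [simp]: "hanoi_nbrs 0 s = {}"
  by (simp add: hanoi_nbrs_def)

lemma hanoi_nbrs_Suc: "hanoi_nbrs (Suc n) s = hanoi_nbrs n s \<union> move_disk s (Suc n)"
  by (simp add: hanoi_nbrs_def atLeastAtMostSuc_conv Un_commute)

lemma finite_hanoi_nbrs: "finite (hanoi_nbrs n s)"
  by (simp add: hanoi_nbrs_def finite_move_disk)

lemma hanoi_nbrs_greater: "t \<in> hanoi_nbrs n s \<Longrightarrow> n < m \<Longrightarrow> t m = s m"
  by (auto simp: hanoi_nbrs_def move_disk_def)

lemma hanoi_nbrs_disjoint: "hanoi_nbrs n s \<inter> move_disk s (Suc n) = {}"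
proof -
  have "t (Suc n) \<noteq> s (Suc n)" if "t \<in> move_disk s (Suc n)" for t
    using that by (auto simp: move_disk_def)
  then show ?thesis
    using hanoi_nbrs_greater[of _ n s "Suc n"] by blast
qed

text \<open>A disk is on top of its peg iff no smaller disk is there, and it fits on
  \<open>q\<close> iff no smaller disk is on \<open>q\<close>.\<close>

lemma legal_move_iff:
  assumes "s \<in> hanoi_states n"
  shows "legal_move n s t \<longleftrightarrow> t \<in> hanoi_nbrs n s"
proof
  assume "legal_move n s t"
  then obtain p q where pq: "p \<noteq> q" "q \<in> {1, 2, 3}" "disks_on n s p \<noteq> {}"
    and q: "disks_on n s q = {} \<or> Min (disks_on n s p) < Min (disks_on n s q)"
    and t: "t = s(Min (disks_on n s p) := q)"
    unfolding legal_move_def by blast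
  let ?d = "Min (disks_on n s p)"
  have fin: "finite (disks_on n s k)" for k
    by (simp add: disks_on_def)
  have d: "?d \<in> {1..n}" "s ?d = p"
    using Min_in[OF fin pq(3)] by (auto simp: disks_on_def)
  have "s e \<noteq> p \<and> s e \<noteq> q" if "e \<in> {1..<?d}" for e
  proof -
    have e: "e \<in> disks_on n s k \<longleftrightarrow> s e = k" for k
      using that d(1) by (auto simp: disks_on_def)
    have "e \<notin> disks_on n s p"
      using Min_le[OF fin, of e p] that by auto
    moreover have "e \<notin> disks_on n s q"
      using Min_le[OF fin, of e q] that q by auto
    ultimately show ?thesis
      using e by blast
  qed
  then show "t \<in> hanoi_nbrs n s"
    unfolding hanoi_nbrs_iff using pq(1,2) d t by (intro exI[of _ ?d] exI[of _ q]) simp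
next
  assume "t \<in> hanoi_nbrs n s"
  then obtain d q where d: "d \<in> {1..n}" and q: "q \<in> {1, 2, 3}" "q \<noteq> s d"
    and top: "\<And>e. e \<in> {1..<d} \<Longrightarrow> s e \<noteq> s d \<and> s e \<noteq> q" and t: "t = s(d := q)"
    unfolding hanoi_nbrs_iff by blast
  have fin: "finite (disks_on n s k)" for k
    by (simp add: disks_on_def)
  have Min: "Min (disks_on n s (s d)) = d"
  proof (rule Min_eqI[OF fin])
    show "d \<le> e" if "e \<in> disks_on n s (s d)" for e
      using that top[of e] by (cases "e < d") (auto simp: disks_on_def)
    show "d \<in> disks_on n s (s d)"
      using d by (simp add: disks_on_def)
  qed
  have "d < Min (disks_on n s q)" if "disks_on n s q \<noteq> {}"
  proof -
    let ?m = "Min (disks_on n s q)"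
    have m: "?m \<in> {1..n}" "s ?m = q"
      using Min_in[OF fin that] by (auto simp: disks_on_def)
    then have "?m \<notin> {1..<d}" "?m \<noteq> d"
      using top[of ?m] q(2) by auto
    then show ?thesis
      using m(1) by auto
  qed
  moreover have "s d \<in> {1, 2, 3}"
    using assms d by (auto simp: hanoi_states_def)
  moreover have "disks_on n s (s d) \<noteq> {}"
    using d by (auto simp: disks_on_def)
  ultimately show "legal_move n s t"
    unfolding legal_move_def using q t Min by (intro bexI[of _ "s d"] bexI[of _ q]) auto
qed

text \<open>The same disk can move back: the smaller disks have not moved, and source and target
  only swap roles.\<close>

lemma hanoi_nbrs_sym:
  assumes "s \<in> hanoi_states n" "t \<in> hanoi_nbrs n s"
  shows "s \<in> hanoi_nbrs n t"
proof -
  obtain d q where d: "d \<in> {1..n}" and q: "q \<in> {1, 2, 3}" "q \<noteq> s d"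
    and top: "\<And>e. e \<in> {1..<d} \<Longrightarrow> s e \<noteq> s d \<and> s e \<noteq> q" and t: "t = s(d := q)"
    using assms(2) unfolding hanoi_nbrs_iff by blast
  have "s d \<in> {1, 2, 3}"
    using assms(1) d by (auto simp: hanoi_states_def)
  moreover have "s = t(d := s d)"
    using t by simp
  moreover have "\<forall>e\<in>{1..<d}. t e \<noteq> t d \<and> t e \<noteq> s d"
    using top t by auto
  moreover have "s d \<noteq> t d"
    using t q(2) by simp
  ultimately show ?thesis
    unfolding hanoi_nbrs_iff using d by blast
qed

lemma hanoi_nbrs_states:
  assumes "s \<in> hanoi_states n" "t \<in> hanoi_nbrs n s"
  shows "t \<in> hanoi_states n"
proof -
  obtain d q where "d \<in> {1..n}" "q \<in> {1, 2, 3}" "t = s(d := q)"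
    using assms(2) unfolding hanoi_nbrs_iff by blast
  then show ?thesis
    using assms(1) by (auto simp: hanoi_states_def PiE_iff extensional_def)
qed

lemma hanoi_graph_nbrs:
  assumes "s \<in> hanoi_states n"
  shows "{t. (s, t) \<in> parcs (hanoi_graph n)} = hanoi_nbrs n s"
proof -
  have "t \<in> hanoi_states n \<and> (legal_move n s t \<or> legal_move n t s) \<longleftrightarrow> t \<in> hanoi_nbrs n s" for t
    using assms legal_move_iff hanoi_nbrs_sym hanoi_nbrs_states by blast
  then show ?thesis
    using assms by (simp add: hanoi_graph_def)
qed

section \<open>The potential\<close>

text \<open>The current entering copy \<open>p\<close> at its corner \<open>q\<close>: the external
  current if \<open>q = p\<close>, otherwise minus the bridge current
  \<open>(i p - i r) / 3\<close>, with the third peg \<open>r\<close> eliminated by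
  \<open>i r = - i p - i q\<close>.\<close>

definition subnet_current :: "(nat \<Rightarrow> real) \<Rightarrow> nat \<Rightarrow> nat \<Rightarrow> real" where
  "subnet_current i p q = (if q = p then i p else - (2 * i p + i q) / 3)"

text \<open>The closed form is \<open>((5/3)^n - 1) / 2\<close>. For one disk, \<open>1/3\<close> is
  the wye of a unit triangle.\<close>

fun wye_resistance :: "nat \<Rightarrow> real" where
  "wye_resistance 0 = 0"
| "wye_resistance (Suc n) = (5 * wye_resistance n + 1) / 3"

text \<open>The offset solves Ohm's law on the bridge from copy \<open>p\<close> to copy
  \<open>r\<close>: without it the drop would be \<open>- 2 * R / 3 * (i p - i r)\<close>, and it
  has to be \<open>(i p - i r) / 3\<close>.\<close>

fun hanoi_potential :: "nat \<Rightarrow> (nat \<Rightarrow> real) \<Rightarrow> (nat \<Rightarrow> nat) \<Rightarrow> real" where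
  "hanoi_potential 0 i s = 0"
| "hanoi_potential (Suc n) i s =
     hanoi_potential n (subnet_current i (s (Suc n))) s
       + (2 * wye_resistance n + 1) / 3 * i (s (Suc n))"

lemma wye_resistance_nonneg: "wye_resistance n \<ge> 0"
  by (induction n) auto

lemma wye_resistance_pos: "n \<ge> 1 \<Longrightarrow> wye_resistance n > 0"
  using wye_resistance_nonneg by (cases n) (simp_all add: add_nonneg_pos)

text \<open>The bridges take \<open>(i p - i q) / 3\<close> and \<open>(i p - i r) / 3\<close> out
  of copy \<open>p\<close>, together \<open>i p\<close>. This makes the induction hypothesis
  applicable to each copy.\<close>

lemma subnet_current_sum:
  assumes "i 1 + i 2 + i 3 = 0" "p \<in> {1, 2, 3}"
  shows "subnet_current i p 1 + subnet_current i p 2 + subnet_current i p 3 = 0"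
  using assms by (auto simp: subnet_current_def field_simps)

text \<open>Corner \<open>p\<close> lies in copy \<open>p\<close>, whose current at \<open>p\<close>
  is again \<open>i p\<close>; adding the offset turns the factor \<open>R\<close> into
  \<open>R + (2 * R + 1) / 3\<close>.\<close>

lemma hanoi_potential_corner:
  "(\<And>d. d \<in> {1..n} \<Longrightarrow> s d = p) \<Longrightarrow> hanoi_potential n i s = wye_resistance n * i p"
  by (induction n arbitrary: i) (auto simp: subnet_current_def field_simps)

text \<open>The largest disk moves only if all others are on the peg \<open>q\<close> that is
  neither source nor target. The pegs sum to 6, which gives the target. Indexing by \<open>q\<close>
  names the corner of the copy at which the bridge starts.\<close>

lemma move_disk_Suc:
  assumes "s ` {1..n} \<subseteq> {1, 2, 3}" "s (Suc n) \<in> {1, 2, 3}"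
  shows "move_disk s (Suc n) = (\<lambda>q. s(Suc n := 6 - s (Suc n) - q)) `
    {q \<in> {1, 2, 3} - {s (Suc n)}. \<forall>e\<in>{1..n}. s e = q}" (is "_ = ?f ` ?Q")
proof
  let ?p = "s (Suc n)"
  have third: "6 - ?p - q \<in> {1, 2, 3} - {?p, q}" "6 - ?p - (6 - ?p - q) = q"
    and eq: "{1, 2, 3} - {?p, 6 - ?p - q} = {q}"
    if "q \<in> {1, 2, 3} - {?p}" for q
    using that assms(2) by auto
  show "move_disk s (Suc n) \<subseteq> ?f ` ?Q"
  proof
    fix t assume "t \<in> move_disk s (Suc n)"
    then obtain q where q: "q \<in> {1, 2, 3} - {?p}" and t: "t = s(Suc n := q)"
      and free: "\<forall>e\<in>{1..n}. s e \<noteq> ?p \<and> s e \<noteq> q"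
      unfolding move_disk_def atLeastLessThanSuc_atLeastAtMost by blast
    let ?r = "6 - ?p - q"
    have r: "?r \<in> {1, 2, 3} - {?p}"
      using third(1)[OF q] by blast
    have "s e = ?r" if "e \<in> {1..n}" for e
    proof -
      have "s e \<in> {1, 2, 3} - {?p, q}"
        using that free assms(1) by blast
      \<comment> \<open>\<open>eq\<close> is used at \<open>?r\<close>, whose third peg is
        \<open>q\<close>, so \<open>?r\<close> alone remains.\<close>
      then show ?thesis
        using eq[OF r, unfolded third(2)[OF q]] by blast
    qed
    then have "?r \<in> ?Q"
      using r by simp
    then show "t \<in> ?f ` ?Q"
      using t third(2)[OF q] by (intro image_eqI[of _ _ ?r]) simp_all
  qed
  show "?f ` ?Q \<subseteq> move_disk s (Suc n)"
  proof
    fix t assume "t \<in> ?f ` ?Q"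
    then obtain q where q: "q \<in> {1, 2, 3} - {?p}" and t: "t = s(Suc n := 6 - ?p - q)"
      and all: "\<forall>e\<in>{1..n}. s e = q"
      by blast
    then show "t \<in> move_disk s (Suc n)"
      using third(1)[OF q] unfolding move_disk_def by (intro CollectI exI[of _ "6 - ?p - q"]) auto
  qed
qed

text \<open>
  For \<open>n = 0\<close> the three corners coincide, and all three currents enter at the same node.
\<close>

lemma hanoi_potential_divergence:
  assumes "s ` {1..n} \<subseteq> {1, 2, 3}" "i 1 + i 2 + i 3 = 0"
  shows "(\<Sum>t\<in>hanoi_nbrs n s. hanoi_potential n i s - hanoi_potential n i t)
    = (\<Sum>q\<in>{1, 2, 3}. if \<forall>e\<in>{1..n}. s e = q then i q else 0)"
  using assms
proof (induction n arbitrary: i)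
  case 0
  then show ?case by simp
next
  case (Suc n)
  define p where "p = s (Suc n)"
  define j where "j = subnet_current i p"
  let ?V = "hanoi_potential (Suc n) i" and ?R = "wye_resistance n"
  let ?all = "\<lambda>q. \<forall>e\<in>{1..n}. s e = q"
  let ?Q = "{q \<in> {1, 2, 3} - {p}. ?all q}"
  have p: "p \<in> {1, 2, 3}" and small: "s ` {1..n} \<subseteq> {1, 2, 3}"
    using Suc.prems(1) by (auto simp: p_def image_subset_iff)
  \<comment> \<open>These moves stay in copy \<open>p\<close>, so the offset cancels.\<close>
  have "(\<Sum>t\<in>hanoi_nbrs n s. ?V s - ?V t)
      = (\<Sum>t\<in>hanoi_nbrs n s. hanoi_potential n j s - hanoi_potential n j t)"
    by (intro sum.cong) (simp_all add: hanoi_nbrs_greater j_def p_def)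
  also have "\<dots> = (\<Sum>q\<in>{1, 2, 3}. if ?all q then j q else 0)"
    using small subnet_current_sum[OF Suc.prems(2) p] unfolding j_def by (rule Suc.IH)
  also have "\<dots> = (if ?all p then i p else 0) + (\<Sum>q\<in>{1, 2, 3} - {p}. if ?all q then j q else 0)"
    by (subst sum.remove[OF _ p]) (simp_all add: j_def subnet_current_def)
  also have "(\<Sum>q\<in>{1, 2, 3} - {p}. if ?all q then j q else 0) = (\<Sum>q\<in>?Q. j q)"
    by (rule sum.inter_filter[symmetric]) simp
  finally have inner: "(\<Sum>t\<in>hanoi_nbrs n s. ?V s - ?V t) = (if ?all p then i p else 0) + (\<Sum>q\<in>?Q. j q)" .
  have inj: "inj_on (\<lambda>q. s(Suc n := 6 - p - q)) ?Q"
  proof (rule inj_onI)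
    fix q q' assume "q \<in> ?Q" "q' \<in> ?Q" "s(Suc n := 6 - p - q) = s(Suc n := 6 - p - q')"
    then have "6 - p - q = 6 - p - q'"
      by (metis fun_upd_same)
    then show "q = q'"
      using p \<open>q \<in> ?Q\<close> \<open>q' \<in> ?Q\<close> by auto
  qed
  \<comment> \<open>Ohm's law on a bridge of resistance 1: the drop is the current leaving copy
    \<open>p\<close> at its corner \<open>q\<close>.\<close>
  have top: "?V s - ?V (s(Suc n := 6 - p - q)) = - j q" if q: "q \<in> ?Q" for q
  proof -
    let ?r = "6 - p - q"
    have "hanoi_potential n k (s(Suc n := ?r)) = ?R * k q" "hanoi_potential n k s = ?R * k q" for k
      using q by (auto intro!: hanoi_potential_corner)
    then have diff: "?V s - ?V (s(Suc n := ?r))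
        = ?R * (j q - subnet_current i ?r q) + (2 * ?R + 1) / 3 * (i p - i ?r)"
      by (simp add: p_def j_def algebra_simps)
    have ne: "q \<noteq> p" "q \<noteq> ?r" and "i q = - i p - i ?r"
      using p q Suc.prems(2) by auto
    \<comment> \<open>What leaves copy \<open>p\<close> at its corner \<open>q\<close> enters copy
      \<open>?r\<close> at its corner \<open>q\<close>.\<close>
    then have "i p - i ?r = - 3 * j q" "subnet_current i ?r q = - j q"
      by (simp_all add: j_def subnet_current_def field_simps)
    then show ?thesis
      unfolding diff by (simp only:) (simp add: field_simps)
  qed
  have "(\<Sum>t\<in>move_disk s (Suc n). ?V s - ?V t) = (\<Sum>q\<in>?Q. ?V s - ?V (s(Suc n := 6 - p - q)))"
    using move_disk_Suc[OF small p[unfolded p_def]] sum.reindex[OF inj]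
    unfolding p_def by (simp only: o_def)
  also have "\<dots> = - (\<Sum>q\<in>?Q. j q)"
    using top by (simp add: sum_negf)
  \<comment> \<open>The bridge currents cancel against those at the bridged corners, leaving the
    external current at corner \<open>p\<close>.\<close>
  finally have "(\<Sum>t\<in>hanoi_nbrs (Suc n) s. ?V s - ?V t) = (if ?all p then i p else 0)"
    using inner unfolding hanoi_nbrs_Suc
    by (subst sum.union_disjoint) (auto simp: finite_hanoi_nbrs finite_move_disk hanoi_nbrs_disjoint)
  also have "\<dots> = (\<Sum>q\<in>{1, 2, 3}. if q = p then if ?all q then i q else 0 else 0)"
    using p by (subst sum.delta) auto
  also have "\<dots> = (\<Sum>q\<in>{1, 2, 3}. if \<forall>e\<in>{1..Suc n}. s e = q then i q else 0)"
  proof (rule sum.cong[OF refl])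
    fix q
    have "(\<forall>e\<in>{1..Suc n}. s e = q) \<longleftrightarrow> q = p \<and> ?all q"
      by (auto simp: p_def le_Suc_eq)
    then show "(if q = p then if ?all q then i q else 0 else 0)
        = (if \<forall>e\<in>{1..Suc n}. s e = q then i q else 0)"
      by simp
  qed
  finally show ?case .
qed

section \<open>Effective resistances between corners\<close>

lemma effective_resistance_hanoi_graph:
  assumes n: "n \<ge> 1" and p: "p \<in> {1, 2, 3}" and q: "q \<in> {1, 2, 3}"
  shows "effective_resistance (hanoi_graph n) (\<lambda>_ _. 1) (corner n p) (corner n q)
    = (if p = q then 0 else 2 * wye_resistance n)"
proof -
  \<comment> \<open>A unit current in at \<open>p\<close> and out at \<open>q\<close>; it vanishes
    when \<open>p = q\<close>.\<close>
  define i :: "nat \<Rightarrow> real" where "i k = of_bool (k = p) - of_bool (k = q)" for k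
  have i: "i 1 + i 2 + i 3 = 0"
    using p q by (auto simp: i_def)
  have "unit_current_potential (hanoi_graph n) (\<lambda>_ _. 1) (corner n p) (corner n q)
      (hanoi_potential n i)"
    unfolding unit_current_potential_def
  proof
    fix s assume "s \<in> pverts (hanoi_graph n)"
    then have s: "s \<in> hanoi_states n"
      by (simp add: hanoi_graph_def)
    \<comment> \<open>States are extensional, so their pegs on \<open>{1..n}\<close> decide equality
      with a corner.\<close>
    then have corner: "s = corner n k \<longleftrightarrow> (\<forall>e\<in>{1..n}. s e = k)" for k
      by (auto simp: corner_def hanoi_states_def PiE_iff extensional_def fun_eq_iff)
    have "s ` {1..n} \<subseteq> {1, 2, 3}"
      using s by (auto simp: hanoi_states_def)
    then have "(\<Sum>t | (s, t) \<in> parcs (hanoi_graph n).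
          (hanoi_potential n i s - hanoi_potential n i t) / 1)
        = (\<Sum>k\<in>{1, 2, 3}. if s = corner n k then i k else 0)"
      using hanoi_potential_divergence[OF _ i, of s n] by (simp only: hanoi_graph_nbrs[OF s] corner div_by_1)
    also have "\<dots> = (\<Sum>k\<in>{1, 2, 3}. (if k = p then if s = corner n p then 1 else 0 else 0)
        - (if k = q then if s = corner n q then 1 else 0 else 0))"
      by (intro sum.cong) (auto simp: i_def)
    also have "\<dots> = (if s = corner n p then 1 else 0) - (if s = corner n q then 1 else 0)"
      using p q by (subst sum_subtractf, subst (1 2) sum.delta) auto
    finally show "(\<Sum>t | (s, t) \<in> parcs (hanoi_graph n).
          (hanoi_potential n i s - hanoi_potential n i t) / 1)
        = (if s = corner n p then 1 else 0) - (if s = corner n q then 1 else 0)" .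
  qed
  moreover have "pair_pseudo_graph (hanoi_graph n)"
    using pair_graph_hanoi_graph by (simp add: pair_graph_def)
  moreover have "corner n k \<in> pverts (hanoi_graph n)" if "k \<in> {1, 2, 3}" for k
    using that corners_subset[of n] by (auto simp: hanoi_graph_def corners_def)
  ultimately have "effective_resistance (hanoi_graph n) (\<lambda>_ _. 1) (corner n p) (corner n q)
      = hanoi_potential n i (corner n p) - hanoi_potential n i (corner n q)"
    using p q by (intro effective_resistance_eqI) auto
  moreover have "hanoi_potential n i (corner n k) = wye_resistance n * i k" for k
    by (intro hanoi_potential_corner) (simp add: corner_def)
  ultimately show ?thesis
    by (simp add: i_def)
qed

theorem theorem2:
  fixes n :: nat
  assumes "n \<ge> 1"
  shows "\<exists>R::real. R > 0 \<and>
    equivalent_networks (corners n) Some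
      (hanoi_graph n) (\<lambda>_ _. 1) (star_graph (corners n)) (\<lambda>_ _. R) \<and>
    (\<forall>a\<in>corners n. \<forall>b\<in>corners n. a \<noteq> b \<longrightarrow>
      effective_resistance (hanoi_graph n) (\<lambda>_ _. 1) a b = 2 * R)"
proof -
  let ?R = "wye_resistance n"
  have R: "?R > 0"
    using assms by (rule wye_resistance_pos)
  \<comment> \<open>Disk 1 exists and shows the peg.\<close>
  have inj: "corner n p = corner n q \<longleftrightarrow> p = q" for p q
    using assms by (auto simp: corner_def fun_eq_iff restrict_def)
  have hanoi: "effective_resistance (hanoi_graph n) (\<lambda>_ _. 1) a b = (if a = b then 0 else 2 * ?R)"
    if ab: "a \<in> corners n" "b \<in> corners n" for a b
  proof -
    obtain p q where "p \<in> {1, 2, 3}" "q \<in> {1, 2, 3}" "a = corner n p" "b = corner n q"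
      using ab unfolding corners_def by blast
    then show ?thesis
      using effective_resistance_hanoi_graph[OF assms] by (simp only: inj)
  qed
  moreover have "effective_resistance (star_graph (corners n)) (\<lambda>_ _. ?R) (Some a) (Some b)
      = (if a = b then 0 else 2 * ?R)"
    if "a \<in> corners n" "b \<in> corners n" for a b
    using that R by (intro effective_resistance_star_graph) (simp_all add: corners_def)
  ultimately show ?thesis
    using R unfolding equivalent_networks_def by (intro exI[of _ ?R]) simp
qed

end
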